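(* Consider a regular MPC (rMPC) problem with data $f, g, c, d$, feasible control set $U=\{u\in\mathbb{R}^n : d(u)\le 0\}$, implicit state map $u\mapsto x(u)$, map $T = g\circ x : U \to Y:=T[U]\subset\mathbb{R}^n$, and the reduced problem $$\min_{u}\ (f\circ T)(u)\quad\text{subject to}\quad d(u)\le 0 .$$ Let $(u^*,\lambda^* )$ be a KKT point of this reduced problem such that $u^*\in\operatorname{int} U$. Then $u^*$ is a global minimum of $f\circ T$ on $U$.
   Context: **Problem data.** Let $f:\mathbb{R}^n\to\mathbb{R}$, $g:\mathbb{R}^m\to\mathbb{R}^n$, $c:\mathbb{R}^m\times\mathbb{R}^n\to\mathbb{R}^m$ and $d=(d_i)_{i\in\mathcal{I}}:\mathbb{R}^n\to\mathbb{R}^{\mathcal{I}}$ ($\mathcal{I}$ a finite index set) be continuously differentiable. The optimization problem is $\min_{x,u} (f\circ g)(x)$ subject to $c(x,u)=0$, $d(u)\le 0$ (component-wise), with states $x\in\mathbb{R}^m$ and controls $u\in\mathbb{R}^n$. Set $U:=\{u\in\mathbb{R}^n : d(u)\le 0\}$. $\nabla_x,\nabla_u$ denote matrices of partial derivatives. **Regular MPC (rMPC) problem.** The problem is called regular if: 1. the set $U$ of admissible controls is bounded, being described by the inequality constraints $d(u)\le 0$, which depend on $u$ only; 2. no explicit constraints or bounds are imposed on the states $x\in\mathbb{R}^m$; 3. $\nabla_x c(x,u)$ is square and full-rank for all $(x,u)$ with $c(x,u)=0$, $u\in U$; 4. $\nabla_u c(x,u)$ is full-rank for all $(x,u)$ with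 $c(x,u)=0$, $u\in U$; 5. for all $u\in U$, the gradients $\nabla_u d_i(u)$ of the active constraints (those $i\in\mathcal{I}$ with $d_i(u)=0$) are linearly independent; 6. for every $u\in U$, the equation $c(x,u)=0$ has a unique solution $x$; 7. the $n\times n$ matrix $-\nabla_x g(x)\,(\nabla_x c(x,u))^{-1}\,\nabla_u c(x,u)$ is invertible for all $(x,u)$ with $c(x,u)=0$, $u\in U$; 8. $f$ is convex. **Reduced problem.** For $u\in U$ let $x(u)$ be the unique solution of $c(x(u),u)=0$. Put $T(u):=g(x(u))$ and $Y:=T[U]$. By the implicit function theorem, $D_uT(u)=-\nabla_x g(x(u))\,(\nabla_x c(x(u),u))^{-1}\,\nabla_u c(x(u),u)$ for $u\in U$. **KKT point.** $(u^*,\lambda^* )\in\mathbb{R}^n\times\mathbb{R}^{\mathcal{I}}$ is a KKT point of the reduced problem if $d(u^* )\le 0$, $\lambda^*\ge 0$, $\lambda_i^* d_i(u^* )=0$ for all $i\in\mathcal{I}$, and $\nabla f(T(u^* ))\,D_uT(u^* )+\lambda^{*T}\nabla_u d(u^* )=0$ (gradients as row vectors). $\operatorname{int} U$ is the topological interior of $U$ in $\mathbb{R}^n$. *)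

theory Defs
  imports "HOL-Analysis.Analysis"
begin

definition continuously_differentiable ::
  "('a::real_normed_vector \<Rightarrow> 'b::real_normed_vector) \<Rightarrow> bool" where
  "continuously_differentiable F \<longleftrightarrow>
     (\<exists>F' :: 'a \<Rightarrow> 'a \<Rightarrow>\<^sub>L 'b.
        (\<forall>x. (F has_derivative blinfun_apply (F' x)) (at x)) \<and> continuous_on UNIV F')"

definition gradient :: "(real^'n \<Rightarrow> real) \<Rightarrow> real^'n \<Rightarrow> real^'n" where
  "gradient h x = (\<chi> j. frechet_derivative h (at x) (axis j 1))"

definition full_rank :: "real^'n^'m \<Rightarrow> bool" where
  "full_rank A \<longleftrightarrow> rank A = min CARD('m) CARD('n)"

definition grad_x :: "((real^'m) \<times> (real^'n) \<Rightarrow> real^'k) \<Rightarrow> real^'m \<Rightarrow> real^'n \<Rightarrow> real^'m^'k" where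
  "grad_x c x u = jacobian (\<lambda>y. c (y, u)) (at x)"

definition grad_u :: "((real^'m) \<times> (real^'n) \<Rightarrow> real^'k) \<Rightarrow> real^'m \<Rightarrow> real^'n \<Rightarrow> real^'n^'k" where
  "grad_u c x u = jacobian (\<lambda>v. c (x, v)) (at u)"

(* The order on real^'i is component-wise. *)
definition admissible :: "(real^'n \<Rightarrow> real^'i) \<Rightarrow> (real^'n) set" where
  "admissible d = {u. d u \<le> 0}"

definition active :: "(real^'n \<Rightarrow> real^'i) \<Rightarrow> real^'n \<Rightarrow> 'i set" where
  "active d u = {i. d u $ i = 0}"

(* Squareness of grad_x c x u is built into the type of c.
   The active gradients must be independent as an indexed family, hence the inj_on:
   two active constraints with equal gradients are dependent. *)
definition regular_MPC ::
  "(real^'n \<Rightarrow> real) \<Rightarrow> (real^'m \<Rightarrow> real^'n) \<Rightarrow> ((real^'m) \<times> (real^'n) \<Rightarrow> real^'m) \<Rightarrow>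
   (real^'n \<Rightarrow> real^'i) \<Rightarrow> bool" where
  "regular_MPC f g c d \<longleftrightarrow>
     continuously_differentiable f \<and> continuously_differentiable g \<and>
     continuously_differentiable c \<and> continuously_differentiable d \<and>
     bounded (admissible d) \<and>
     (\<forall>u\<in>admissible d. \<forall>x. c (x, u) = 0 \<longrightarrow> full_rank (grad_x c x u)) \<and>
     (\<forall>u\<in>admissible d. \<forall>x. c (x, u) = 0 \<longrightarrow> full_rank (grad_u c x u)) \<and>
     (\<forall>u\<in>admissible d.
        inj_on (\<lambda>i. gradient (\<lambda>v. d v $ i) u) (active d u) \<and>
        independent ((\<lambda>i. gradient (\<lambda>v. d v $ i) u) ` active d u)) \<and>
     (\<forall>u\<in>admissible d. \<exists>!x. c (x, u) = 0) \<and>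
     (\<forall>u\<in>admissible d. \<forall>x. c (x, u) = 0 \<longrightarrow>
        invertible (- (jacobian g (at x) ** matrix_inv (grad_x c x u) ** grad_u c x u))) \<and>
     convex_on UNIV f"

(* state c u and reduced_map g c u are meaningful for u in admissible d only. *)
definition state :: "((real^'m) \<times> (real^'n) \<Rightarrow> real^'m) \<Rightarrow> real^'n \<Rightarrow> real^'m" where
  "state c u = (THE x. c (x, u) = 0)"

definition reduced_map ::
  "(real^'m \<Rightarrow> real^'n) \<Rightarrow> ((real^'m) \<times> (real^'n) \<Rightarrow> real^'m) \<Rightarrow> real^'n \<Rightarrow> real^'n" where
  "reduced_map g c u = g (state c u)"

(* The derivative is taken relative to U, the domain of the reduced map. For a regular
   problem it exists at every u in U, is unique there (the independence of the active
   gradients gives U full-dimensional tangent cones), and equals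
   - jacobian g ** matrix_inv (grad_x c) ** grad_u c, evaluated at (state c u, u),
   by the implicit function theorem. *)
definition reduced_jacobian ::
  "(real^'m \<Rightarrow> real^'n) \<Rightarrow> ((real^'m) \<times> (real^'n) \<Rightarrow> real^'m) \<Rightarrow> (real^'n \<Rightarrow> real^'i) \<Rightarrow>
   real^'n \<Rightarrow> real^'n^'n" where
  "reduced_jacobian g c d u = jacobian (reduced_map g c) (at u within admissible d)"

definition KKT_point ::
  "(real^'n \<Rightarrow> real) \<Rightarrow> (real^'m \<Rightarrow> real^'n) \<Rightarrow> ((real^'m) \<times> (real^'n) \<Rightarrow> real^'m) \<Rightarrow>
   (real^'n \<Rightarrow> real^'i) \<Rightarrow> real^'n \<Rightarrow> real^'i \<Rightarrow> bool" where
  "KKT_point f g c d u l \<longleftrightarrow>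
     d u \<le> 0 \<and> 0 \<le> l \<and> (\<forall>i. l $ i * d u $ i = 0) \<and>
     gradient f (reduced_map g c u) v* reduced_jacobian g c d u + l v* jacobian d (at u) = 0"

end

theory Submission
  imports Defs
begin

text \<open>No constraint is active at the interior point u*, so the multiplier is 0 and the KKT
  condition reads grad f(T u*) DT(u*) = 0. By the implicit function theorem DT(u*) is the matrix
  that regularity makes invertible, so T(u*) is a critical point of the convex function f
  and hence a global minimum of it on the whole space.\<close>

text \<open>Obtained from the inverse function theorem for \<open>G (x, u) = (F (x, u), u)\<close>.
  If its derivative at \<open>(a, b)\<close> kills \<open>(h, k)\<close>, then \<open>k = 0\<close>,
  and \<open>inj\<close> gives \<open>h = 0\<close>. The local inverse sends \<open>(0, u)\<close>
  to a point \<open>(\<xi> u, u)\<close> on the zero set of \<open>F\<close>. Neither uniqueness of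
  \<xi> nor a formula for its derivative is asserted; both come later from the problem data.\<close>

lemma implicit_function:
  fixes F :: "'a::euclidean_space \<times> 'b::euclidean_space \<Rightarrow> 'a"
    and F' :: "'a \<times> 'b \<Rightarrow> ('a \<times> 'b) \<Rightarrow>\<^sub>L 'a"
  assumes der: "\<And>z. (F has_derivative blinfun_apply (F' z)) (at z)"
    and cont: "continuous_on UNIV F'"
    and zero: "F (a, b) = 0"
    and inj: "\<And>h. blinfun_apply (F' (a, b)) (h, 0) = 0 \<Longrightarrow> h = 0"
  obtains \<xi> \<xi>' W where "open W" "b \<in> W" "\<xi> b = a" "\<And>u. u \<in> W \<Longrightarrow> F (\<xi> u, u) = 0"
    "(\<xi> has_derivative \<xi>') (at b)"
proof -
  define G where "G z = (F z, snd z)" for z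
  \<comment> \<open>The derivative of \<open>G\<close> is assembled from the embedding
    \<open>P\<close> of the first factor and the projection \<open>Q\<close> to the second, so that
    its continuity in operator norm follows from that of \<open>F'\<close>.\<close>
  define P :: "'a \<Rightarrow>\<^sub>L ('a \<times> 'b)" where "P = Blinfun (\<lambda>x. (x, 0))"
  define Q :: "('a \<times> 'b) \<Rightarrow>\<^sub>L ('a \<times> 'b)" where "Q = Blinfun (\<lambda>h. (0, snd h))"
  define G' where "G' z = (P o\<^sub>L F' z) + Q" for z
  have P: "blinfun_apply P x = (x, 0)" for x
    unfolding P_def by (subst bounded_linear_Blinfun_apply) (auto intro!: bounded_linear_intros)
  have Q: "blinfun_apply Q h = (0, snd h)" for h
    unfolding Q_def by (subst bounded_linear_Blinfun_apply) (auto intro!: bounded_linear_intros)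
  have G': "blinfun_apply (G' z) h = (blinfun_apply (F' z) h, snd h)" for z h
    by (simp add: G'_def plus_blinfun.rep_eq P Q)
  have derG: "(G has_derivative blinfun_apply (G' z)) (at z)" for z
    unfolding G_def G' by (auto intro!: derivative_eq_intros der)
  have contG: "continuous_on UNIV G'"
    unfolding G'_def by (intro continuous_intros cont)
  have "inj (blinfun_apply (G' (a, b)))"
  proof (rule injI)
    fix h k assume "blinfun_apply (G' (a, b)) h = blinfun_apply (G' (a, b)) k"
    then have "blinfun_apply (F' (a, b)) (h - k) = 0" and snd: "snd h = snd k"
      by (simp_all add: G' blinfun.diff_right)
    moreover have "h - k = (fst h - fst k, 0)"
      using snd by (simp add: prod_eq_iff)
    ultimately have "fst h - fst k = 0"
      using inj by metis
    with snd show "h = k" by (simp add: prod_eq_iff)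
  qed
  \<comment> \<open>The inverse function theorem takes invertibility of the derivative as a bounded
    left inverse. In finite dimension injectivity provides a linear one, and linearity makes it
    bounded.\<close>
  then obtain L where L: "linear L" "L \<circ> blinfun_apply (G' (a, b)) = id"
    using linear_injective_left_inverse blinfun.bounded_linear_right bounded_linear.linear
    by metis
  have invL: "Blinfun L o\<^sub>L G' (a, b) = id_blinfun"
    using L(1) fun_cong[OF L(2)] by (intro blinfun_eqI)
      (simp add: bounded_linear_Blinfun_apply linear_conv_bounded_linear del: split_paired_All)
  obtain U V \<Gamma> \<Gamma>' where U: "open U" "(a, b) \<in> U" "open V" "G (a, b) \<in> V"
    and hom: "homeomorphism U V G \<Gamma>"
    and der\<Gamma>: "\<And>y. y \<in> V \<Longrightarrow> (\<Gamma> has_derivative \<Gamma>' y) (at y)"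
    by (rule inverse_function_theorem[OF open_UNIV derG contG UNIV_I invL]) blast
  have G0: "G (a, b) = (0, b)"
    by (simp add: G_def zero)
  show thesis
  proof
    \<comment> \<open>The branch is the first component of the local inverse along the slice
      \<open>(0, u)\<close>; its domain is the preimage of \<open>V\<close> under that
      slice.\<close>
    show "open ((\<lambda>u. (0, u)) -` V)"
      using U(3) by (intro open_vimage continuous_intros)
    show "b \<in> (\<lambda>u. (0, u)) -` V"
      using U(4) G0 by simp
    show "fst (\<Gamma> (0, b)) = a"
      using homeomorphism_apply1[OF hom U(2)] G0 by simp
    show "F (fst (\<Gamma> (0, u)), u) = 0" if "u \<in> (\<lambda>u. (0, u)) -` V" for u
    proof -
      have "G (\<Gamma> (0, u)) = (0, u)"
        using homeomorphism_apply2[OF hom] that by simp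
      then show ?thesis
        by (metis G_def fst_conv snd_conv prod.collapse)
    qed
    have "((\<lambda>u. \<Gamma> (0, u)) has_derivative (\<lambda>k. \<Gamma>' (0, b) (0, k))) (at b)"
      by (rule has_derivative_compose[where g = \<Gamma>, OF _ der\<Gamma>])
        (use U(4) G0 in \<open>auto intro!: derivative_eq_intros\<close>)
    then show "((\<lambda>u. fst (\<Gamma> (0, u))) has_derivative (\<lambda>k. fst (\<Gamma>' (0, b) (0, k)))) (at b)"
      by (rule has_derivative_fst)
  qed
qed

lemma jacobian_at:
  fixes F :: "real^'p \<Rightarrow> real^'q"
  assumes "(F has_derivative F') (at x)"
  shows "jacobian F (at x) *v h = F' h"
proof -
  have "(F has_derivative (\<lambda>h. jacobian F (at x) *v h)) (at x)"
    using assms by (simp add: differentiableI flip: jacobian_works)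
  then show ?thesis
    using has_derivative_unique[OF assms] by simp
qed

lemma has_derivative_imp_jacobian_eq:
  fixes F :: "real^'p \<Rightarrow> real^'q"
  assumes "(F has_derivative (\<lambda>h. A *v h)) (at x)"
  shows "jacobian F (at x) = A"
  using jacobian_at[OF assms] by (simp add: matrix_eq)

text \<open>The entries of the gradient are the values of the derivative on the standard basis, and
  these determine a linear map.\<close>

lemma gradient_zero_iff:
  assumes "(h has_derivative h') (at x)"
  shows "gradient h x = 0 \<longleftrightarrow> h' = (\<lambda>_. 0)"
proof
  assume "gradient h x = 0"
  then have "h' (axis j 1) = 0" for j
    using frechet_derivative_at[OF assms] by (simp add: gradient_def vec_eq_iff)
  then have "h' b = 0" if "b \<in> Basis" for b
    using that by (auto simp: Basis_vec_def)
  then show "h' = (\<lambda>_. 0)"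
    using linear_eq_stdbasis[OF has_derivative_linear[OF assms], of "\<lambda>_. 0"]
    by (simp add: linear_zero)
next
  assume "h' = (\<lambda>_. 0)"
  then show "gradient h x = 0"
    using frechet_derivative_at[OF assms] by (simp add: gradient_def vec_eq_iff)
qed

text \<open>Restricted to the line through \<open>y\<close> and \<open>x\<close>, the function is
  convex on the reals with slope 0 at parameter 0, so it lies above a horizontal tangent.\<close>

lemma convex_critical_point_imp_minimum:
  fixes f :: "'a::real_normed_vector \<Rightarrow> real"
  assumes convex: "convex_on UNIV f" and der: "(f has_derivative (\<lambda>_. 0)) (at y)"
  shows "f y \<le> f x"
proof -
  let ?p = "\<lambda>t::real. y + t *\<^sub>R (x - y)"
  have "convex_on UNIV (\<lambda>t. f (?p t))"
  proof (rule convex_onI)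
    fix t s r :: real assume "0 < t" "t < 1"
    moreover have "?p ((1 - t) *\<^sub>R s + t *\<^sub>R r) = (1 - t) *\<^sub>R ?p s + t *\<^sub>R ?p r"
      by (simp add: algebra_simps)
    ultimately show "f (?p ((1 - t) *\<^sub>R s + t *\<^sub>R r)) \<le> (1 - t) * f (?p s) + t * f (?p r)"
      using convex_onD[OF convex, of t "?p s" "?p r"] by simp
  qed simp
  moreover have "((\<lambda>t. f (?p t)) has_derivative (\<lambda>_. 0)) (at 0)"
    by (rule has_derivative_compose[where g = f and g' = "\<lambda>_. 0"])
      (auto intro!: derivative_eq_intros simp: der)
  then have "((\<lambda>t. f (?p t)) has_field_derivative 0) (at 0)"
    by (simp add: has_field_derivative_def lambda_zero)
  \<comment> \<open>The left side is the slope at 0 times the parameter increment from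
    \<open>y\<close> (at 0) to \<open>x\<close> (at 1).\<close>
  ultimately have "0 * (1 - 0) \<le> f (?p 1) - f (?p 0)"
    by (intro convex_on_imp_above_tangent[where A = UNIV]) auto
  then show ?thesis by simp
qed

text \<open>\<open>matrix_inv\<close> is a choice of two-sided inverse, so its equations rest on the
  existence of one.\<close>

lemma invertible_matrix_inv:
  assumes "invertible A"
  shows "A ** matrix_inv A = mat 1" and "matrix_inv A ** A = mat 1"
  using someI_ex[OF assms[unfolded invertible_def]] by (simp_all add: matrix_inv_def)

lemma full_rank_square_invertible:
  fixes A :: "real^'m^'m"
  assumes "full_rank A"
  shows "invertible A"
proof -
  have "rank A = CARD('m)"
    using assms by (simp add: full_rank_def)
  then show ?thesis
    unfolding full_rank_injective invertible_left_inverse matrix_left_invertible_injective .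
qed

text \<open>An active constraint attains a local maximum at an interior point, so its gradient would
  vanish there.\<close>

lemma interior_no_active:
  assumes dd: "continuously_differentiable d"
    and ind: "independent ((\<lambda>i. gradient (\<lambda>v. d v $ i) u) ` active d u)"
    and int: "u \<in> interior (admissible d)"
  shows "active d u = {}"
proof (rule equals0I)
  fix i assume i: "i \<in> active d u"
  obtain D where D: "(d has_derivative D) (at u)"
    using dd by (auto simp: continuously_differentiable_def)
  then have der: "((\<lambda>v. d v $ i) has_derivative (\<lambda>h. D h $ i)) (at u)"
    by (rule bounded_linear.has_derivative[OF bounded_linear_vec_nth])
  \<comment> \<open>Feasibility of \<open>v\<close> bounds the left side by 0, the value of the
    active constraint at \<open>u\<close>.\<close>
  have "d v $ i \<le> d u $ i" if "v \<in> interior (admissible d)" for v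
    using subsetD[OF interior_subset that] i
    by (simp add: admissible_def active_def less_eq_vec_def)
  then have "(\<lambda>h. D h $ i) = (\<lambda>_. 0)"
    using differential_zero_maxmin[OF int open_interior der] by blast
  then have "gradient (\<lambda>v. d v $ i) u = 0"
    using gradient_zero_iff[OF der] by blast
  then show False
    using ind i dependent_zero by (metis imageI)
qed

text \<open>Differentiating \<open>c (\<xi> v, v) = 0\<close> along a local branch \<xi> gives
  \<open>?A *v \<xi>' k + ?B *v k = 0\<close>, which is solved for \<open>\<xi>' k\<close> and
  passed through \<open>g\<close> by the chain rule. Since \<open>u\<close> is interior, the branch
  agrees with \<open>state c\<close> on a full neighbourhood, which yields an unrestricted
  derivative.\<close>

lemma reduced_map_has_derivative:
  fixes c :: "(real^'m) \<times> (real^'n) \<Rightarrow> real^'m" and g :: "real^'m \<Rightarrow> real^'n"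
  assumes cg: "continuously_differentiable g" and cc: "continuously_differentiable c"
    and sol: "\<And>u. u \<in> S \<Longrightarrow> \<exists>!x. c (x, u) = 0"
    and u: "u \<in> interior S"
    and inv: "invertible (grad_x c (state c u) u)"
  shows "(reduced_map g c has_derivative
     (\<lambda>k. (- (jacobian g (at (state c u)) ** matrix_inv (grad_x c (state c u) u)
        ** grad_u c (state c u) u)) *v k)) (at u)"
proof -
  let ?x = "state c u"
  let ?A = "grad_x c ?x u" and ?B = "grad_u c ?x u"
  have state_eq: "state c v = x" if "v \<in> S" "c (x, v) = 0" for v x
    unfolding state_def using sol[OF that(1)] that(2) by (rule the1_equality)
  have zero: "c (?x, u) = 0"
    unfolding state_def using sol[OF subsetD[OF interior_subset u]] by (rule theI')
  obtain c' :: "(real^'m) \<times> (real^'n) \<Rightarrow> ((real^'m) \<times> (real^'n)) \<Rightarrow>\<^sub>L (real^'m)"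
    where c': "\<And>z. (c has_derivative blinfun_apply (c' z)) (at z)" "continuous_on UNIV c'"
    using cc unfolding continuously_differentiable_def by blast
  obtain g' where g': "(g has_derivative g') (at ?x)"
    using cg unfolding continuously_differentiable_def by blast
  \<comment> \<open>The partial Jacobians are the restrictions of the total derivative to the two
    coordinate subspaces.\<close>
  have A: "?A *v h = c' (?x, u) (h, 0)" for h
    unfolding grad_x_def
    by (rule jacobian_at, rule has_derivative_compose[where g = c, OF _ c'(1)])
      (auto intro!: derivative_eq_intros)
  have B: "?B *v k = c' (?x, u) (0, k)" for k
    unfolding grad_u_def
    by (rule jacobian_at, rule has_derivative_compose[where g = c, OF _ c'(1)])
      (auto intro!: derivative_eq_intros)
  have cancel: "matrix_inv ?A *v (?A *v h) = h" for h
    using invertible_matrix_inv(2)[OF inv] by (simp add: matrix_vector_mul_assoc)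
  have inj: "h = 0" if "c' (?x, u) (h, 0) = 0" for h
    using cancel[of h] that by (simp add: A)
  obtain \<xi> \<xi>' W where W: "open W" "u \<in> W" "\<xi> u = ?x" "\<And>v. v \<in> W \<Longrightarrow> c (\<xi> v, v) = 0"
    and \<xi>: "(\<xi> has_derivative \<xi>') (at u)"
    using implicit_function[OF c' zero inj] by metis
  have "((\<lambda>v. c (\<xi> v, v)) has_derivative (\<lambda>k. c' (?x, u) (\<xi>' k, k))) (at u)"
    by (rule has_derivative_compose[where g = c])
      (auto intro!: derivative_eq_intros \<xi> simp: W(3) c'(1))
  \<comment> \<open>The same function vanishes identically on \<open>W\<close>; comparing its two
    derivatives yields the linear equation for \<xi>'.\<close>
  moreover have "((\<lambda>v. c (\<xi> v, v)) has_derivative (\<lambda>k. 0)) (at u)"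
    by (rule has_derivative_transform_within_open[OF has_derivative_const W(1,2)]) (simp add: W(4))
  ultimately have "c' (?x, u) (\<xi>' k, k) = 0" for k
    by (rule fun_cong[OF has_derivative_unique])
  then have "?A *v \<xi>' k + ?B *v k = 0" for k
    by (simp add: A B flip: blinfun.add_right)
  then have "?A *v \<xi>' k = - (?B *v k)" for k
    by (simp add: eq_neg_iff_add_eq_0)
  then have \<xi>'_eq: "\<xi>' k = - (matrix_inv ?A *v (?B *v k))" for k
    using cancel[of "\<xi>' k"] by (simp add: linear_neg[OF matrix_vector_mul_linear])
  have "((\<lambda>v. g (\<xi> v)) has_derivative (\<lambda>k. g' (\<xi>' k))) (at u)"
    using \<xi> by (rule has_derivative_compose[where g = g]) (simp add: W(3) g')
  \<comment> \<open>On \<open>S\<close> the solution of the state equation is unique, so any local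
    branch must be the state map.\<close>
  moreover have "state c v = \<xi> v" if "v \<in> W \<inter> interior S" for v
    using state_eq W(4) that interior_subset by blast
  ultimately have "(reduced_map g c has_derivative (\<lambda>k. g' (\<xi>' k))) (at u)"
    by (elim has_derivative_transform_within_open[where s = "W \<inter> interior S"])
      (use W(1,2) u in \<open>auto simp: reduced_map_def\<close>)
  moreover have "g' (\<xi>' k) = (- (jacobian g (at ?x) ** matrix_inv ?A ** ?B)) *v k" for k
    unfolding jacobian_at[OF g', symmetric] \<xi>'_eq
    \<comment> \<open>Reading the negated matrix as a difference from 0 moves the minus sign outside
      the matrix-vector product.\<close>
    using matrix_vector_mult_diff_rdistrib[of 0 "jacobian g (at ?x) ** matrix_inv ?A ** ?B" k]
    by (simp add: linear_neg[OF matrix_vector_mul_linear] matrix_vector_mul_assoc matrix_mul_assoc)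
  ultimately show ?thesis by simp
qed

theorem corollary1:
  fixes f :: "real^'n \<Rightarrow> real"
    and g :: "real^'m \<Rightarrow> real^'n"
    and c :: "(real^'m) \<times> (real^'n) \<Rightarrow> real^'m"
    and d :: "real^'n \<Rightarrow> real^'i"
    and u_star :: "real^'n" and lambda_star :: "real^'i"
  assumes "regular_MPC f g c d"
    and "KKT_point f g c d u_star lambda_star"
    and "u_star \<in> interior (admissible d)"
  shows "is_arg_min (f \<circ> reduced_map g c) (\<lambda>u. u \<in> admissible d) u_star"
proof -
  let ?x = "state c u_star" and ?y = "reduced_map g c u_star"
  define M where "M = - (jacobian g (at ?x) ** matrix_inv (grad_x c ?x u_star)
    ** grad_u c ?x u_star)"
  have smooth: "continuously_differentiable f" "continuously_differentiable g"
      "continuously_differentiable c" "continuously_differentiable d"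
    and rank: "\<forall>u\<in>admissible d. \<forall>x. c (x, u) = 0 \<longrightarrow> full_rank (grad_x c x u)"
    and ind: "\<forall>u\<in>admissible d.
        inj_on (\<lambda>i. gradient (\<lambda>v. d v $ i) u) (active d u) \<and>
        independent ((\<lambda>i. gradient (\<lambda>v. d v $ i) u) ` active d u)"
    and sol: "\<forall>u\<in>admissible d. \<exists>!x. c (x, u) = 0"
    and inv: "\<forall>u\<in>admissible d. \<forall>x. c (x, u) = 0 \<longrightarrow>
        invertible (- (jacobian g (at x) ** matrix_inv (grad_x c x u) ** grad_u c x u))"
    and convex: "convex_on UNIV f"
    using assms(1) unfolding regular_MPC_def by - (elim conjE, assumption)+
  have compl: "\<forall>i. lambda_star $ i * d u_star $ i = 0"
    and stat: "gradient f ?y v* reduced_jacobian g c d u_star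
      + lambda_star v* jacobian d (at u_star) = 0"
    using assms(2) by (simp_all add: KKT_point_def)
  have u: "u_star \<in> admissible d"
    using assms(3) interior_subset by blast
  have zero: "c (?x, u_star) = 0"
    unfolding state_def using bspec[OF sol u] by (rule theI')
  have "(reduced_map g c has_derivative (\<lambda>k. M *v k)) (at u_star)"
    unfolding M_def
  proof (rule reduced_map_has_derivative[OF smooth(2,3) _ assms(3)])
    show "\<exists>!x. c (x, v) = 0" if "v \<in> admissible d" for v
      using sol that by (rule bspec)
    show "invertible (grad_x c ?x u_star)"
      using rank u zero by (intro full_rank_square_invertible) simp
  qed
  \<comment> \<open>At an interior point the derivative relative to the admissible set is the
    ordinary one.\<close>
  then have jac: "reduced_jacobian g c d u_star = M"
    unfolding reduced_jacobian_def at_within_interior[OF assms(3)]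
    by (rule has_derivative_imp_jacobian_eq)
  have "active d u_star = {}"
    using bspec[OF ind u] by (intro interior_no_active smooth assms(3)) simp
  \<comment> \<open>Every \<open>d u_star $ i\<close> is nonzero, so complementarity forces each
    multiplier to vanish.\<close>
  then have "lambda_star = 0"
    using compl by (simp add: active_def vec_eq_iff)
  then have "gradient f ?y v* M = 0"
    using stat jac by simp
  moreover have M: "invertible M"
    unfolding M_def using inv u zero by simp
  \<comment> \<open>Multiply the stationarity equation on the right by the inverse of
    \<open>M\<close>.\<close>
  ultimately have grad: "gradient f ?y = 0"
    using vector_matrix_mul_assoc[of "gradient f ?y" M "matrix_inv M"]
    by (simp add: invertible_matrix_inv(1)[OF M])
  obtain f' where f': "(f has_derivative f') (at ?y)"
    using smooth(1) unfolding continuously_differentiable_def by blast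
  then have "(f has_derivative (\<lambda>_. 0)) (at ?y)"
    using gradient_zero_iff[OF f'] grad by simp
  \<comment> \<open>The bound holds at every point of the space, in particular at the images of all
    admissible controls; convexity of \<open>f\<close> composed with the reduced map is never
    claimed.\<close>
  then have "f ?y \<le> f z" for z
    by (rule convex_critical_point_imp_minimum[OF convex])
  then show ?thesis
    using u by (simp add: is_arg_min_linorder)
qed

end
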